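(* Let $X$ be a real Hilbert space, let $f:X\to\mathbb{R}$ be locally Lipschitz continuous, and let $(x_k)_{k\in\mathbb{N}}$ be a sequence of iteration points produced by the Main Algorithm (described in the context) applied to $f$. Then $\big(f(x_k)\big)_k$ is strictly decreasing. Moreover, if $x$ is an accumulation point of $(x_k)$, then $0\in\partial f(x)$ and $f(x_k)\to f(x)$ as $k\to\infty$.
   Context: **Gradients.** $X$ is a real Hilbert space with norm $\|\cdot\|$ and inner product $\langle\cdot,\cdot\rangle$. For a locally Lipschitz $f:X\to\mathbb{R}$, $f^0(y;h)=\limsup_{z\to y,\,t\downarrow 0}\frac{f(z+th)-f(z)}{t}$ is Clarke's generalized directional derivative and $\partial f(y)=\{a\in X: \langle a,h\rangle\le f^0(y;h)\ \forall h\in X\}$ is Clarke's generalized gradient. If $\|\cdot\|_k$ is an equivalent norm on $X$ induced by an inner product $\langle\cdot,\cdot\rangle_k$, then "$\partial f(y)$ with respect to $\|\cdot\|_k$" means $\{a\in X:\langle a,h\rangle_k\le f^0(y;h)\ \forall h\in X\}$. For $\varepsilon>0$, "$\partial^{\varepsilon}f(x)$ with respect to $\|\cdot\|_k$" is the closed convex hull of the union of the sets $\partial f(y)$ (w.r.t. $\|\cdot\|_k$) over all $y$ with $\|y-x\|_k\le\varepsilon$. The condition $0\in\partial f(x)$ does not depend on the choice of equivalent norm. **Control functions.** $T_1,T_2:\mathbb{R}_{>0}\to\mathbb{R}_{>0}$ are non-decreasing with $\lim_{t\to0}T_1(t)=0$ and $\lim_{n\to\infty}T_2^n(t)=0$ for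 all $t>0$ ($T_2^n$ is the $n$-fold composition). $G:\mathbb{R}_{>0}^2\to\mathbb{R}_{>0}$ has at least one of the properties: (a) $G(s_k,t_k)\to0$ implies $s_k\to0$ for any sequences $(s_k),(t_k)$; (b) for any $s_0>0$ there is some $t_0>0$ such that $G(s,t)\ge t$ for all $s>s_0$ and $t<t_0$. **Norms.** The norms $\|\cdot\|_k$ ($k\in\mathbb{N}$) used below are induced by inner products $\langle\cdot,\cdot\rangle_k$ and are uniformly equivalent to $\|\cdot\|$: there is $C\ge1$ with $\frac1C\|\cdot\|\le\|\cdot\|_k\le C\|\cdot\|$ for all $k$. **Main Algorithm.** 1. Choose non-decreasing functions $T_1,T_2:\mathbb{R}_{>0}\to\mathbb{R}_{>0}$ with $\lim_{t\to0}T_1(t)=0$ and $\lim_{n\to\infty}T_2^n(t)=0$ for all $t>0$, a function $G:\mathbb{R}_{>0}^2\to\mathbb{R}_{>0}$ having at least one of the properties (a), (b) of the control functions, $\delta\in\,]0,1[$, $x_0\in X$, $\varepsilon_0>0$; set $i=k=0$. 2. Choose a norm $\|\cdot\|_k$ on $X$ induced by an inner product $\langle\cdot,\cdot\rangle_k$ and satisfying $\frac1C\|\cdot\|\le\|\cdot\|_k\le C\|\cdot\|$ (with the constant $C\ge1$ independent of $k$), some $a_k\in\partial f(x_k)$ (w.r.t. $\|\cdot\|_k$), and some $\varepsilon_{k,0}\ge G(\|a_k\|_k,\varepsilon_k)$ (if $a_k=0$, just $\varepsilon_{k,0}>0$). 3. Determine by Subroutine A an element $a_{k,i}\in\partial^{\varepsilon_{k,i}}f(x_k)$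 (w.r.t. $\|\cdot\|_k$) satisfying the null step condition (N): $\|a_{k,i}\|_k<T_1(\varepsilon_{k,i})$, or the condition of sufficient descent (D): $f(x_k-\varepsilon_{k,i}h_{k,i})-f(x_k)\le-\delta\|a_{k,i}\|_k\,\varepsilon_{k,i}$ with $h_{k,i}=a_{k,i}/\|a_{k,i}\|_k$. 4. If (N) holds, set $\varepsilon_{k,i+1}:=T_2(\varepsilon_{k,i})$, increase $i$ by one, and go to Step 3. 5. If (N) does not hold, choose $\sigma_k\ge\varepsilon_{k,i}$ with $f(x_k-\sigma_kh_{k,i})-f(x_k)\le-\delta\|a_{k,i}\|_k\,\sigma_k$, set $x_{k+1}:=x_k-\sigma_kh_{k,i}$ and $\varepsilon_{k+1}:=\varepsilon_{k,i}$, increase $k$ by one, set $i=0$, and go to Step 2. **Subroutine A** (for given $k,i$). 1. Choose $a'_0\in\partial f(x_k)$ (w.r.t. $\|\cdot\|_k$) and $\delta'\in\,]\delta,1[$; set $j=0$. 2. Set $a_{k,i}:=a'_j$, $h'_j:=a'_j/\|a'_j\|_k$. If $a_{k,i}$ satisfies (N) or (D), stop and return $a_{k,i}$. 3. Otherwise compute by Subroutine B some $b'_j\in\partial f(y_j)$ (w.r.t. $\|\cdot\|_k$) for some $y_j\in[x_k,x_k-\varepsilon_{k,i}h'_j]$ such that $\langle a'_j,b'_j\rangle_k\le\delta'\|a'_j\|_k^2$. 4. Choose $B'_j\subseteq\{a'_l:l\le j\}\cup\{b'_l:l\le j\}$ with $a'_j,b'_j\in B'_j$ and set $A'_j:=\operatorname{conv}B'_j$.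 5. Let $a'_{j+1}$ be the element of $A'_j$ with minimal norm $\|\cdot\|_k$; increase $j$ by one and go to Step 2. **Subroutine B** (for given $k,i,j$). 1. Set $l=0$, $x''_0:=x_k$, $y''_0:=x_k-2\varepsilon_{k,i}h'_j$. 2. Choose $b''_l\in\partial f\big(\frac{x''_l+y''_l}{2}\big)$ (w.r.t. $\|\cdot\|_k$). 3. If $\langle a'_j,b''_l\rangle_k\le\delta'\|a'_j\|_k^2$, stop and return $b'_j:=b''_l$. 4. Otherwise choose $x''_{l+1}\in\{x''_l,\frac{x''_l+y''_l}{2}\}$ and $y''_{l+1}\in\{\frac{x''_l+y''_l}{2},y''_l\}$ such that $\|y''_{l+1}-x''_{l+1}\|_k=\frac12\|y''_l-x''_l\|_k$ and $f(y''_{l+1})-f(x''_{l+1})>-\delta\|a'_j\|_k\|y''_{l+1}-x''_{l+1}\|_k$, where $x''_1=x''_0$ is taken if $l=0$. 5. Increase $l$ by one and go to Step 2. That $(x_k)_{k\in\mathbb{N}}$ is a sequence of iteration points produced by the Main Algorithm means that it is an infinite sequence obtained in this way; in particular all inner loops terminated. *)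

theory Defs
  imports "HOL-Analysis.Analysis"
begin

definition locally_lipschitz :: "('a::metric_space \<Rightarrow> 'b::metric_space) \<Rightarrow> bool" where
  "locally_lipschitz f \<longleftrightarrow> (\<forall>x. \<exists>r>0. \<exists>L. L-lipschitz_on (ball x r) f)"

definition inner_product :: "('a::real_vector \<Rightarrow> 'a \<Rightarrow> real) \<Rightarrow> bool" where
  "inner_product ip \<longleftrightarrow>
     bilinear ip \<and> (\<forall>x y. ip x y = ip y x) \<and> (\<forall>x. x \<noteq> 0 \<longrightarrow> 0 < ip x x)"

definition ip_norm :: "('a \<Rightarrow> 'a \<Rightarrow> real) \<Rightarrow> 'a \<Rightarrow> real" where
  "ip_norm ip x = sqrt (ip x x)"

text \<open>The upper limit is taken in the extended reals, where it always exists; for locally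
  Lipschitz functions it is finite. The base point \<open>z\<close> may equal \<open>y\<close>, hence \<^term>\<open>nhds y\<close>.\<close>

definition clarke_deriv :: "('a::real_normed_vector \<Rightarrow> real) \<Rightarrow> 'a \<Rightarrow> 'a \<Rightarrow> ereal" where
  "clarke_deriv f y h =
     Limsup (nhds y \<times>\<^sub>F at_right 0) (\<lambda>(z, t). ereal ((f (z + t *\<^sub>R h) - f z) / t))"

definition clarke_gradient ::
    "('a \<Rightarrow> 'a \<Rightarrow> real) \<Rightarrow> ('a::real_normed_vector \<Rightarrow> real) \<Rightarrow> 'a \<Rightarrow> 'a set" where
  "clarke_gradient ip f y = {a. \<forall>h. ereal (ip a h) \<le> clarke_deriv f y h}"

definition eps_gradient ::
    "('a \<Rightarrow> 'a \<Rightarrow> real) \<Rightarrow> ('a::real_normed_vector \<Rightarrow> real) \<Rightarrow> real \<Rightarrow> 'a \<Rightarrow> 'a set" where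
  "eps_gradient ip f \<epsilon> x =
     closure (convex hull (\<Union>y\<in>{y. ip_norm ip (y - x) \<le> \<epsilon>}. clarke_gradient ip f y))"

text \<open>Functions on the positive reals are represented by functions on all reals (or pairs of
  reals) whose values at non-positive arguments are irrelevant.\<close>

definition control_functions ::
    "(real \<Rightarrow> real) \<Rightarrow> (real \<Rightarrow> real) \<Rightarrow> (real \<Rightarrow> real \<Rightarrow> real) \<Rightarrow> bool" where
  "control_functions T1 T2 G \<longleftrightarrow>
     (\<forall>t>0. 0 < T1 t) \<and> mono_on {0<..} T1 \<and> (T1 \<longlongrightarrow> 0) (at_right 0) \<and>
     (\<forall>t>0. 0 < T2 t) \<and> mono_on {0<..} T2 \<and> (\<forall>t>0. (\<lambda>n. (T2 ^^ n) t) \<longlonglongrightarrow> 0) \<and>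
     (\<forall>s>0. \<forall>t>0. 0 < G s t) \<and>
     ((\<forall>s t. (\<forall>k::nat. 0 < s k \<and> 0 < t k) \<longrightarrow>
          (\<lambda>k. G (s k) (t k)) \<longlonglongrightarrow> 0 \<longrightarrow> s \<longlonglongrightarrow> 0) \<or>
      (\<forall>s0>0. \<exists>t0>0. \<forall>s t. s0 < s \<longrightarrow> 0 < t \<longrightarrow> t < t0 \<longrightarrow> t \<le> G s t))"

text \<open>The normalized direction; it is only relevant for \<open>a \<noteq> 0\<close>, since \<open>a = 0\<close> always
  satisfies the null step condition.\<close>

definition direction :: "('a \<Rightarrow> 'a \<Rightarrow> real) \<Rightarrow> 'a::real_vector \<Rightarrow> 'a" where
  "direction ip a = a /\<^sub>R ip_norm ip a"

definition null_step :: "('a \<Rightarrow> 'a \<Rightarrow> real) \<Rightarrow> (real \<Rightarrow> real) \<Rightarrow> real \<Rightarrow> 'a \<Rightarrow> bool" where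
  "null_step ip T1 \<epsilon> a \<longleftrightarrow> ip_norm ip a < T1 \<epsilon>"

definition sufficient_descent ::
    "('a \<Rightarrow> 'a \<Rightarrow> real) \<Rightarrow> ('a::real_vector \<Rightarrow> real) \<Rightarrow> real \<Rightarrow> 'a \<Rightarrow> real \<Rightarrow> 'a \<Rightarrow> bool" where
  "sufficient_descent ip f \<delta> x \<sigma> a \<longleftrightarrow>
     f (x - \<sigma> *\<^sub>R direction ip a) - f x \<le> - \<delta> * ip_norm ip a * \<sigma>"

text \<open>Subroutine B, started at \<open>x\<close> with radius \<open>\<epsilon>\<close> and \<open>a = a'\<^sub>j\<close>, can stop after finitely many
  bisections and return \<open>b\<close>, an element of the gradient at the point \<open>y\<close>. The sequences
  \<open>u, v, c\<close> are the \<open>x'', y'', b''\<close> of the algorithm; only their entries up to the stopping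
  index \<open>L\<close> matter.\<close>

definition subroutine_B ::
    "('a \<Rightarrow> 'a \<Rightarrow> real) \<Rightarrow> ('a::real_normed_vector \<Rightarrow> real) \<Rightarrow> real \<Rightarrow> real \<Rightarrow> 'a \<Rightarrow> real \<Rightarrow>
     'a \<Rightarrow> 'a \<Rightarrow> 'a \<Rightarrow> bool" where
  "subroutine_B ip f \<delta> \<delta>' x \<epsilon> a y b \<longleftrightarrow>
     (\<exists>L u v c.
        u 0 = x \<and> v 0 = x - (2 * \<epsilon>) *\<^sub>R direction ip a \<and>
        (\<forall>l\<le>L. c l \<in> clarke_gradient ip f (midpoint (u l) (v l))) \<and>
        (\<forall>l<L.
           \<not> ip a (c l) \<le> \<delta>' * (ip_norm ip a)\<^sup>2 \<and>
           u (Suc l) \<in> {u l, midpoint (u l) (v l)} \<and>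
           v (Suc l) \<in> {midpoint (u l) (v l), v l} \<and>
           ip_norm ip (v (Suc l) - u (Suc l)) = 1 / 2 * ip_norm ip (v l - u l) \<and>
           f (v (Suc l)) - f (u (Suc l))
             > - \<delta> * ip_norm ip a * ip_norm ip (v (Suc l) - u (Suc l)) \<and>
           (l = 0 \<longrightarrow> u (Suc l) = u l)) \<and>
        ip a (c L) \<le> \<delta>' * (ip_norm ip a)\<^sup>2 \<and>
        y = midpoint (u L) (v L) \<and> b = c L)"

text \<open>Subroutine A at \<open>x\<close> with radius \<open>\<epsilon>\<close> can stop and return \<open>a\<close>. The sequences
  \<open>p, b, y, B\<close> are the \<open>a', b', y, B'\<close> of the algorithm and \<open>J\<close> is the stopping index.\<close>

definition subroutine_A ::
    "('a \<Rightarrow> 'a \<Rightarrow> real) \<Rightarrow> ('a::real_normed_vector \<Rightarrow> real) \<Rightarrow> (real \<Rightarrow> real) \<Rightarrow> real \<Rightarrow>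
     'a \<Rightarrow> real \<Rightarrow> 'a \<Rightarrow> bool" where
  "subroutine_A ip f T1 \<delta> x \<epsilon> a \<longleftrightarrow>
     (\<exists>\<delta>' J p b y B.
        \<delta> < \<delta>' \<and> \<delta>' < 1 \<and>
        p 0 \<in> clarke_gradient ip f x \<and>
        (\<forall>j<J.
           \<not> (null_step ip T1 \<epsilon> (p j) \<or> sufficient_descent ip f \<delta> x \<epsilon> (p j)) \<and>
           subroutine_B ip f \<delta> \<delta>' x \<epsilon> (p j) (y j) (b j) \<and>
           y j \<in> closed_segment x (x - \<epsilon> *\<^sub>R direction ip (p j)) \<and>
           b j \<in> clarke_gradient ip f (y j) \<and>
           ip (p j) (b j) \<le> \<delta>' * (ip_norm ip (p j))\<^sup>2 \<and>
           B j \<subseteq> p ` {..j} \<union> b ` {..j} \<and> p j \<in> B j \<and> b j \<in> B j \<and>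
           is_arg_min (ip_norm ip) (\<lambda>z. z \<in> convex hull (B j)) (p (Suc j))) \<and>
        (null_step ip T1 \<epsilon> (p J) \<or> sufficient_descent ip f \<delta> x \<epsilon> (p J)) \<and>
        a = p J)"

text \<open>The transition from \<open>(x\<^sub>k, \<epsilon>\<^sub>k)\<close> to \<open>(x\<^sub>k\<^sub>+\<^sub>1, \<epsilon>\<^sub>k\<^sub>+\<^sub>1)\<close>, here from \<open>(x, \<epsilon>)\<close> to \<open>(x', \<epsilon>')\<close>,
  once the inner product has been chosen: \<open>a\<close> is \<open>a\<^sub>k\<close>, the sequences \<open>e, g\<close> are
  \<open>\<epsilon>\<^sub>k\<^sub>,\<^sub>i, a\<^sub>k\<^sub>,\<^sub>i\<close>, and \<open>n\<close> is the finite number of null steps.\<close>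

definition outer_step ::
    "('a \<Rightarrow> 'a \<Rightarrow> real) \<Rightarrow> ('a::real_normed_vector \<Rightarrow> real) \<Rightarrow>
     (real \<Rightarrow> real) \<Rightarrow> (real \<Rightarrow> real) \<Rightarrow> (real \<Rightarrow> real \<Rightarrow> real) \<Rightarrow> real \<Rightarrow>
     'a \<Rightarrow> real \<Rightarrow> 'a \<Rightarrow> real \<Rightarrow> bool" where
  "outer_step ip f T1 T2 G \<delta> x \<epsilon> x' \<epsilon>' \<longleftrightarrow>
     (\<exists>a e g n \<sigma>.
        a \<in> clarke_gradient ip f x \<and>
        (if a = 0 then 0 < e 0 else G (ip_norm ip a) \<epsilon> \<le> e 0) \<and>
        (\<forall>i\<le>n. g i \<in> eps_gradient ip f (e i) x \<and> subroutine_A ip f T1 \<delta> x (e i) (g i)) \<and>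
        (\<forall>i<n. null_step ip T1 (e i) (g i) \<and> e (Suc i) = T2 (e i)) \<and>
        \<not> null_step ip T1 (e n) (g n) \<and>
        e n \<le> \<sigma> \<and> sufficient_descent ip f \<delta> x \<sigma> (g n) \<and>
        x' = x - \<sigma> *\<^sub>R direction ip (g n) \<and> \<epsilon>' = e n)"

definition main_algorithm_iterates ::
    "('a::real_normed_vector \<Rightarrow> real) \<Rightarrow> (nat \<Rightarrow> 'a) \<Rightarrow> bool" where
  "main_algorithm_iterates f xs \<longleftrightarrow>
     (\<exists>T1 T2 G \<delta> C ip \<epsilon>.
        control_functions T1 T2 G \<and> 0 < \<delta> \<and> \<delta> < 1 \<and> 1 \<le> C \<and> 0 < \<epsilon> 0 \<and>
        (\<forall>k. inner_product (ip k) \<and>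
             (\<forall>z. 1 / C * norm z \<le> ip_norm (ip k) z \<and> ip_norm (ip k) z \<le> C * norm z) \<and>
             outer_step (ip k) f T1 T2 G \<delta> (xs k) (\<epsilon> k) (xs (Suc k)) (\<epsilon> (Suc k))))"

definition accumulation_point :: "(nat \<Rightarrow> 'a::topological_space) \<Rightarrow> 'a \<Rightarrow> bool" where
  "accumulation_point xs x \<longleftrightarrow> (\<exists>r. strict_mono r \<and> (xs \<circ> r) \<longlonglongrightarrow> x)"

end

theory Submission imports Defs begin

text \<open>
  Every step of the algorithm that ends with radius \<open>\<epsilon>'\<close> decreases \<open>f\<close> by at least
  \<open>\<delta> * T1 \<epsilon>' * \<epsilon>'\<close>, which is positive because all radii are. So the values strictly decrease.
  If \<open>x\<close> is an accumulation point, then they converge to \<open>f x\<close> by continuity, hence their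
  differences tend to zero, and, \<open>T1\<close> being monotone and positive, the radii \<open>\<epsilon> k\<close> tend to zero.

  Suppose now that \<open>0\<close> is no Clarke gradient of \<open>f\<close> at \<open>x\<close>. Then some direction \<open>h\<close> has a
  negative generalized derivative at \<open>x\<close>, and even one below a fixed \<open>- c < 0\<close> on a ball
  around \<open>x\<close> (\<open>nonstationary_descent_direction\<close>). All gradients on that ball lie in the
  closed half-space of those \<open>a\<close> whose product with \<open>h\<close> is at most \<open>- c\<close>. This half-space
  contains the \<open>\<epsilon>\<close>-gradients of nearby points for small \<open>\<epsilon>\<close>, so by the Cauchy-Schwarz
  inequality there is a bound \<open>m > 0\<close> for the norms of all these elements
  (\<open>eps_gradient_norm_lower_bound\<close>). The bound is the same for all \<open>k\<close> since the norms are
  uniformly equivalent.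

  Near \<open>x\<close> a null step is thus only possible with a radius that is not small, and it would leave
  a radius that is not small. For large \<open>k\<close> this is excluded, as the radii tend to zero; so every
  late step from a point near \<open>x\<close> is made without null steps, with a descent of at least
  \<open>\<delta> * m\<close> times its length (\<open>outer_step_without_null_steps\<close>). The length of the path is
  therefore controlled by the decrease of \<open>f\<close>, which traps the iterates near \<open>x\<close> once one of
  them is close enough (\<open>trapped_by_descent\<close>). From then on the next radius is at least
  \<open>G \<parallel>a\<^sub>k\<parallel> (\<epsilon> k)\<close> with \<open>\<parallel>a\<^sub>k\<parallel> \<ge> m\<close>, and each of the two alternative properties of \<open>G\<close>
  contradicts that the radii tend to zero: the first would give \<open>\<parallel>a\<^sub>k\<parallel> \<longlonglongrightarrow> 0\<close>, the second would
  make the radii eventually non-decreasing.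
\<close>

section \<open>Equivalent inner products\<close>

lemma inner_product_norm_square:
  assumes "inner_product ip"
  shows "0 \<le> ip x x" and "(ip_norm ip x)\<^sup>2 = ip x x"
proof -
  have "ip 0 0 = 0"
    using assms by (simp add: inner_product_def bilinear_lzero)
  then show "0 \<le> ip x x"
    using assms by (cases "x = 0") (auto simp: inner_product_def less_imp_le)
  then show "(ip_norm ip x)\<^sup>2 = ip x x"
    by (simp add: ip_norm_def)
qed

lemma ip_norm_nonneg: "inner_product ip \<Longrightarrow> 0 \<le> ip_norm ip x"
  by (simp add: ip_norm_def inner_product_norm_square)

lemma ip_norm_scaleR:
  assumes "inner_product ip"
  shows "ip_norm ip (t *\<^sub>R x) = \<bar>t\<bar> * ip_norm ip x"
proof -
  have "ip (t *\<^sub>R x) (t *\<^sub>R x) = t\<^sup>2 * ip x x"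
    using assms by (simp add: inner_product_def bilinear_lmul bilinear_rmul power2_eq_square)
  then show ?thesis
    by (simp add: ip_norm_def real_sqrt_mult)
qed

lemma ip_norm_direction:
  assumes "inner_product ip" "ip_norm ip a \<noteq> 0"
  shows "ip_norm ip (direction ip a) = 1"
  using assms ip_norm_nonneg[of ip a] by (simp add: direction_def ip_norm_scaleR)

lemma inner_product_Cauchy_Schwarz:
  assumes ip: "inner_product ip"
  shows "\<bar>ip x y\<bar> \<le> ip_norm ip x * ip_norm ip y"
proof (cases "y = 0")
  case True
  then have "ip x y = 0"
    using ip unfolding inner_product_def by (metis bilinear_rzero)
  then show ?thesis
    using ip by (simp add: ip_norm_nonneg)
next
  case False
  then have pos: "0 < ip y y"
    using ip by (simp add: inner_product_def)
  define t where "t = ip x y / ip y y"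
  have "0 \<le> ip (x - t *\<^sub>R y) (x - t *\<^sub>R y)"
    by (rule inner_product_norm_square[OF ip])
  also have "\<dots> = ip x x - 2 * t * ip x y + t * t * ip y y"
    using ip by (simp add: inner_product_def bilinear_lsub bilinear_rsub bilinear_lmul
        bilinear_rmul algebra_simps)
  also have "\<dots> = ip x x - (ip x y)\<^sup>2 / ip y y"
    using pos by (simp add: t_def power2_eq_square field_simps)
  finally have "(ip x y)\<^sup>2 \<le> (ip_norm ip x * ip_norm ip y)\<^sup>2"
    using pos by (simp add: power_mult_distrib inner_product_norm_square[OF ip] field_simps)
  then show ?thesis
    using ip by (metis abs_le_square_iff abs_of_nonneg ip_norm_nonneg mult_nonneg_nonneg)
qed

lemma inner_product_linear_left: "inner_product ip \<Longrightarrow> linear (\<lambda>a. ip a h)"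
  by (simp add: inner_product_def bilinear_def)

lemma closed_inner_product_halfspace:
  fixes ip :: "'a::real_normed_vector \<Rightarrow> 'a \<Rightarrow> real"
  assumes ip: "inner_product ip" and le: "\<And>z. ip_norm ip z \<le> C * norm z"
  shows "closed {a. ip a h \<le> c}"
proof -
  have "\<bar>ip a h\<bar> \<le> norm a * (C * ip_norm ip h)" for a
    using inner_product_Cauchy_Schwarz[OF ip, of a h]
      mult_right_mono[OF le[of a] ip_norm_nonneg[OF ip, of h]] by (simp add: mult_ac)
  then have "bounded_linear (\<lambda>a. ip a h)"
    using inner_product_linear_left[OF ip]
    by (intro bounded_linear.intro bounded_linear_axioms.intro) auto
  then have "continuous_on UNIV (\<lambda>a. ip a h)"
    by (rule linear_continuous_on)
  then show ?thesis
    by (intro closed_Collect_le) auto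
qed

lemma convex_inner_product_halfspace:
  assumes "inner_product ip"
  shows "convex {a. ip a h \<le> c}"
proof -
  have "convex ((\<lambda>a. ip a h) -` {..c})"
    by (intro convex_linear_vimage inner_product_linear_left assms) simp
  then show ?thesis
    by (simp add: vimage_def)
qed


section \<open>Gradients near a point that is not stationary\<close>

text \<open>An upper bound for the difference quotients at all base points near \<open>x\<close> is one for all
  base points near \<open>y\<close> as soon as \<open>y\<close> is close to \<open>x\<close>; this is why the strict inequality at
  \<open>x\<close> carries over to a ball.\<close>

lemma nonstationary_descent_direction:
  fixes f :: "'a::real_inner \<Rightarrow> real"
  assumes "0 \<notin> clarke_gradient inner f x"
  obtains h c r where "0 < c" "0 < r" "\<And>y. dist y x < r \<Longrightarrow> clarke_deriv f y h \<le> ereal (- c)"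
proof -
  let ?q = "\<lambda>h (z, t). ereal ((f (z + t *\<^sub>R h) - f z) / t)"
  obtain h where "clarke_deriv f x h < 0"
    using assms by (auto simp: clarke_gradient_def not_le zero_ereal_def)
  then obtain d where d: "clarke_deriv f x h < ereal d" "ereal d < 0"
    using ereal_dense2 by blast
  have "\<forall>\<^sub>F p in nhds x \<times>\<^sub>F at_right 0. ?q h p < ereal d"
    using d(1) unfolding clarke_deriv_def by (rule Limsup_lessD)
  then obtain P Q where P: "eventually P (nhds x)" and Q: "eventually Q (at_right (0::real))"
      and PQ: "\<And>z t. P z \<Longrightarrow> Q t \<Longrightarrow> ?q h (z, t) < ereal d"
    unfolding eventually_prod_filter by blast
  obtain r where r: "0 < r" "\<And>z. dist z x < r \<Longrightarrow> P z"
    using P by (auto simp: eventually_nhds_metric)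
  have "clarke_deriv f y h \<le> ereal d" if y: "dist y x < r" for y
  proof -
    have "\<forall>\<^sub>F z in nhds y. z \<in> ball x r"
      using y by (intro eventually_nhds_in_open) (auto simp: dist_commute)
    then have "eventually P (nhds y)"
      by eventually_elim (auto intro: r simp: dist_commute)
    then have "\<forall>\<^sub>F p in nhds y \<times>\<^sub>F at_right 0. ?q h p \<le> ereal d"
      unfolding eventually_prod_filter
      using Q PQ by (blast intro: less_imp_le)
    then show ?thesis
      unfolding clarke_deriv_def by (rule Limsup_bounded)
  qed
  with d(2) r(1) show thesis
    by (intro that[of "- d" r h]) auto
qed

lemma clarke_gradient_subset_eps_gradient:
  assumes "inner_product ip" "0 \<le> \<epsilon>"
  shows "clarke_gradient ip f z \<subseteq> eps_gradient ip f \<epsilon> z"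
proof -
  have "ip_norm ip (z - z) \<le> \<epsilon>"
    using assms ip_norm_scaleR[of ip 0 0] by simp
  then show ?thesis
    unfolding eps_gradient_def
    by (intro order_trans[OF _ closure_subset] order_trans[OF _ hull_subset]) blast
qed

text \<open>The one added to \<open>C * norm h\<close> only keeps the denominator positive.\<close>

lemma eps_gradient_norm_lower_bound:
  fixes f :: "'a::real_normed_vector \<Rightarrow> real"
  assumes ip: "inner_product ip" and C: "0 < C"
    and lower: "\<And>z. 1 / C * norm z \<le> ip_norm ip z"
    and upper: "\<And>z. ip_norm ip z \<le> C * norm z"
    and deriv: "\<And>y. dist y x < r \<Longrightarrow> clarke_deriv f y h \<le> ereal (- c)"
    and z: "dist z x + C * \<epsilon> < r"
    and g: "g \<in> eps_gradient ip f \<epsilon> z"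
  shows "c / (C * norm h + 1) \<le> ip_norm ip g"
proof -
  have "clarke_gradient ip f y \<subseteq> {a. ip a h \<le> - c}" if "ip_norm ip (y - z) \<le> \<epsilon>" for y
  proof -
    have "norm (y - z) \<le> C * ip_norm ip (y - z)"
      using lower[of "y - z"] C by (simp add: field_simps)
    also have "\<dots> \<le> C * \<epsilon>"
      using that C by simp
    finally have "dist y x < r"
      using z dist_triangle[of y x z] by (simp add: dist_norm)
    then have "clarke_deriv f y h \<le> ereal (- c)"
      by (rule deriv)
    then show ?thesis
      unfolding clarke_gradient_def using ereal_less_eq(3) order_trans by blast
  qed
  then have "convex hull (\<Union>y\<in>{y. ip_norm ip (y - z) \<le> \<epsilon>}. clarke_gradient ip f y)
      \<subseteq> {a. ip a h \<le> - c}"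
    by (intro hull_minimal convex_inner_product_halfspace[OF ip]) blast
  then have "eps_gradient ip f \<epsilon> z \<subseteq> {a. ip a h \<le> - c}"
    unfolding eps_gradient_def
    by (intro closure_minimal closed_inner_product_halfspace[OF ip upper])
  with g have "c \<le> \<bar>ip g h\<bar>"
    by auto
  also have "\<dots> \<le> ip_norm ip g * ip_norm ip h"
    by (rule inner_product_Cauchy_Schwarz[OF ip])
  also have "\<dots> \<le> ip_norm ip g * (C * norm h + 1)"
    using upper[of h] by (intro mult_left_mono ip_norm_nonneg[OF ip]) simp
  finally show ?thesis
    using C by (simp add: pos_divide_le_eq add_nonneg_pos)
qed


section \<open>A single step of the algorithm\<close>

lemma control_functionsD:
  assumes "control_functions T1 T2 G"
  shows "0 < t \<Longrightarrow> 0 < T1 t" "mono_on {0<..} T1" "(T1 \<longlongrightarrow> 0) (at_right 0)"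
    and "0 < t \<Longrightarrow> 0 < T2 t" "mono_on {0<..} T2"
    and "0 < s \<Longrightarrow> 0 < t \<Longrightarrow> 0 < G s t"
  using assms unfolding control_functions_def by simp_all

lemma outer_step_descent:
  assumes step: "outer_step ip f T1 T2 G \<delta> x \<epsilon> x' \<epsilon>'" and ip: "inner_product ip"
    and cf: "control_functions T1 T2 G" and "0 < \<delta>" "0 < \<epsilon>"
  shows "0 < \<epsilon>'" and "f x' \<le> f x - \<delta> * T1 \<epsilon>' * \<epsilon>'"
proof -
  obtain a e g n \<sigma> where
      e0: "if a = 0 then 0 < e 0 else G (ip_norm ip a) \<epsilon> \<le> e 0"
      and null: "\<And>i. i < n \<Longrightarrow> e (Suc i) = T2 (e i)"
      and last: "\<not> null_step ip T1 (e n) (g n)" "e n \<le> \<sigma>"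
        "sufficient_descent ip f \<delta> x \<sigma> (g n)"
        "x' = x - \<sigma> *\<^sub>R direction ip (g n)" "\<epsilon>' = e n"
    using step unfolding outer_step_def by blast
  note T1 = control_functionsD(1)[OF cf] and T2 = control_functionsD(4)[OF cf]
    and G = control_functionsD(6)[OF cf]
  have "0 < e 0"
  proof (cases "a = 0")
    case False
    then have "0 < ip_norm ip a"
      using ip by (simp add: ip_norm_def inner_product_def)
    then show ?thesis
      using e0 False G[OF _ \<open>0 < \<epsilon>\<close>] by (metis order_less_le_trans)
  qed (use e0 in simp)
  have pos: "0 < e i" if "i \<le> n" for i
    using that by (induction i) (auto simp: \<open>0 < e 0\<close> null T2)
  then show "0 < \<epsilon>'"
    using last by simp
  have "T1 (e n) * e n \<le> ip_norm ip (g n) * \<sigma>"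
    using last pos[of n] ip_norm_nonneg[OF ip, of "g n"]
    by (intro mult_mono) (auto simp: null_step_def)
  with \<open>0 < \<delta>\<close> have "\<delta> * (T1 (e n) * e n) \<le> \<delta> * (ip_norm ip (g n) * \<sigma>)"
    by (intro mult_left_mono) auto
  then show "f x' \<le> f x - \<delta> * T1 \<epsilon>' * \<epsilon>'"
    using last by (simp add: sufficient_descent_def mult_ac)
qed

text \<open>A null step with radius \<open>t\<close> needs an \<open>\<epsilon>\<close>-gradient of norm less than \<open>T1 t\<close>. If this is
  impossible for \<open>t < \<tau>\<close>, then every null step has radius at least \<open>\<tau>\<close> and is followed by a
  radius of at least \<open>T2 \<tau>\<close>. A step that ends with a smaller radius thus has no null steps, and
  its final radius is the initial one, for which \<open>G\<close> gives a lower bound.\<close>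

lemma outer_step_without_null_steps:
  assumes step: "outer_step ip f T1 T2 G \<delta> x \<epsilon> x' \<epsilon>'" and ip: "inner_product ip"
    and cf: "control_functions T1 T2 G" and "0 < \<delta>" "0 < \<epsilon>" "0 < \<epsilon>'" "0 < m" "0 < \<tau>"
    and bound: "\<And>t g. 0 < t \<Longrightarrow> t < \<tau> \<Longrightarrow> g \<in> eps_gradient ip f t x \<Longrightarrow> m \<le> ip_norm ip g"
    and T1_small: "\<And>t. 0 < t \<Longrightarrow> t < \<tau> \<Longrightarrow> T1 t \<le> m"
    and small: "\<epsilon>' < \<tau>" "\<epsilon>' < T2 \<tau>"
  shows "\<exists>s\<ge>m. G s \<epsilon> \<le> \<epsilon>'" and "\<delta> * m * ip_norm ip (x' - x) \<le> f x - f x'"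
proof -
  obtain a e g n \<sigma> where
      a: "a \<in> clarke_gradient ip f x" "if a = 0 then 0 < e 0 else G (ip_norm ip a) \<epsilon> \<le> e 0"
      and g: "\<And>i. i \<le> n \<Longrightarrow> g i \<in> eps_gradient ip f (e i) x"
      and null: "\<And>i. i < n \<Longrightarrow> null_step ip T1 (e i) (g i) \<and> e (Suc i) = T2 (e i)"
      and last: "e n \<le> \<sigma>" "sufficient_descent ip f \<delta> x \<sigma> (g n)"
        "x' = x - \<sigma> *\<^sub>R direction ip (g n)" "\<epsilon>' = e n"
    using step unfolding outer_step_def by blast
  note T2 = control_functionsD(4)[OF cf] and T2_mono = control_functionsD(5)[OF cf]
    and G = control_functionsD(6)[OF cf]
  have a_ge: "m \<le> ip_norm ip a"
    using bound[of "\<epsilon>'" a] a(1) clarke_gradient_subset_eps_gradient[OF ip, of "\<epsilon>'" f x]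
      \<open>0 < \<epsilon>'\<close> small(1) by auto
  then have "a \<noteq> 0"
    using \<open>0 < m\<close> ip_norm_scaleR[OF ip, of 0 0] by auto
  then have e0_ge: "G (ip_norm ip a) \<epsilon> \<le> e 0"
    using a(2) by simp
  have "n = 0"
  proof (rule ccontr)
    assume "n \<noteq> 0"
    then obtain i where i: "n = Suc i"
      by (cases n) auto
    have gi: "ip_norm ip (g i) < T1 (e i)" and en: "e n = T2 (e i)"
      using null[of i] by (auto simp: i null_step_def)
    have "0 < e i"
    proof -
      have "0 < e j" if "j \<le> i" for j
        using that
      proof (induction j)
        case 0
        then show ?case
          using e0_ge G[of "ip_norm ip a" \<epsilon>] a_ge \<open>0 < m\<close> \<open>0 < \<epsilon>\<close> by linarith
      next
        case (Suc j)
        then show ?case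
          using null[of j] T2[of "e j"] by (simp add: i)
      qed
      then show ?thesis
        by simp
    qed
    then have "\<tau> \<le> e i"
      using bound[of "e i" "g i"] T1_small[of "e i"] g[of i] gi by (force simp: i not_less)
    then have "T2 \<tau> \<le> \<epsilon>'"
      using monotone_onD[OF T2_mono] \<open>0 < \<tau>\<close> en last(4) by simp
    with small(2) show False
      by simp
  qed
  show "\<exists>s\<ge>m. G s \<epsilon> \<le> \<epsilon>'"
    using a_ge e0_ge last(4) \<open>n = 0\<close> by auto
  have gn: "m \<le> ip_norm ip (g n)"
    using bound g[of n] last(4) \<open>0 < \<epsilon>'\<close> small(1) by auto
  have "ip_norm ip (x' - x) = \<bar>- \<sigma>\<bar> * ip_norm ip (direction ip (g n))"
    using ip_norm_scaleR[OF ip, of "- \<sigma>" "direction ip (g n)"] last(3) by simp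
  also have "\<dots> = \<sigma>"
    using ip_norm_direction[OF ip, of "g n"] gn \<open>0 < m\<close> last \<open>0 < \<epsilon>'\<close> by simp
  finally have "\<delta> * m * ip_norm ip (x' - x) = \<delta> * m * \<sigma>"
    by simp
  also have "\<dots> \<le> \<delta> * ip_norm ip (g n) * \<sigma>"
    using gn last \<open>0 < \<delta>\<close> \<open>0 < \<epsilon>'\<close> by (intro mult_right_mono mult_left_mono) auto
  also have "\<dots> \<le> f x - f x'"
    using last by (simp add: sufficient_descent_def)
  finally show "\<delta> * m * ip_norm ip (x' - x) \<le> f x - f x'" .
qed


section \<open>Trapping near the accumulation point\<close>

text \<open>The distance to \<open>x\<close> plus the potential \<open>\<phi>\<close> cannot increase as long as the sequence is in
  the ball, and its being less than \<open>r + l\<close> keeps the next element in the ball.\<close>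

lemma trapped_by_descent:
  fixes u :: "nat \<Rightarrow> 'a::metric_space" and \<phi> :: "nat \<Rightarrow> real"
  assumes step: "\<And>k. K \<le> k \<Longrightarrow> dist (u k) x < r \<Longrightarrow> dist (u (Suc k)) (u k) \<le> \<phi> k - \<phi> (Suc k)"
    and lower: "\<And>k. l \<le> \<phi> k"
    and start: "dist (u K) x + \<phi> K < r + l"
    and "K \<le> k"
  shows "dist (u k) x < r"
proof -
  have "dist (u k) x + \<phi> k < r + l"
    using \<open>K \<le> k\<close>
  proof (induction k rule: dec_induct)
    case (step k)
    then have "dist (u k) x < r"
      using lower[of k] by linarith
    then have "dist (u (Suc k)) (u k) \<le> \<phi> k - \<phi> (Suc k)"
      using assms(1) step by blast
    then show ?case
      using step dist_triangle[of "u (Suc k)" x "u k"] by linarith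
  qed (rule start)
  then show ?thesis
    using lower[of k] by linarith
qed

lemma decseq_tendsto_of_subseq:
  fixes v :: "nat \<Rightarrow> real"
  assumes "decseq v" "strict_mono r" "(v \<circ> r) \<longlonglongrightarrow> l"
  shows "v \<longlonglongrightarrow> l" and "l \<le> v k"
proof -
  have "decseq (v \<circ> r)"
    using assms(1,2) by (auto simp: decseq_def strict_mono_less_eq)
  then have "l \<le> v (r k)" for k
    using decseq_ge[OF _ assms(3)] by fastforce
  then have lower: "l \<le> v k" for k
    by (rule order_trans[OF _ decseqD[OF assms(1) seq_suble[OF assms(2)]]])
  then show "l \<le> v k" .
  obtain L where "v \<longlonglongrightarrow> L"
    using decseq_convergent[OF assms(1)] lower by blast
  with assms(2,3) show "v \<longlonglongrightarrow> l"
    using LIMSEQ_subseq_LIMSEQ LIMSEQ_unique by metis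
qed

lemma locally_lipschitz_isCont:
  assumes "locally_lipschitz f"
  shows "isCont f x"
proof -
  obtain r L where "0 < r" "L-lipschitz_on (ball x r) f"
    using assms unfolding locally_lipschitz_def by blast
  then show ?thesis
    using lipschitz_on_continuous_on continuous_on_eq_continuous_at[of "ball x r" f] by auto
qed

text \<open>If \<open>e k \<ge> c\<close>, then \<open>d k \<ge> T c * c > 0\<close>, which is impossible for large \<open>k\<close>.\<close>

lemma tendsto_zero_of_weighted_bound:
  fixes e d :: "nat \<Rightarrow> real" and T :: "real \<Rightarrow> real"
  assumes mono: "mono_on {0<..} T" and pos: "\<And>t. 0 < t \<Longrightarrow> 0 < T t" "\<And>k. 0 < e k"
    and le: "\<And>k. T (e k) * e k \<le> d k" and d: "d \<longlonglongrightarrow> 0"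
  shows "e \<longlonglongrightarrow> 0"
proof (rule order_tendstoI)
  fix c :: real
  assume "0 < c"
  then have "\<forall>\<^sub>F k in sequentially. d k < T c * c"
    by (intro order_tendstoD(2)[OF d]) (simp add: pos)
  then show "\<forall>\<^sub>F k in sequentially. e k < c"
  proof eventually_elim
    case (elim k)
    show ?case
    proof (rule ccontr)
      assume "\<not> e k < c"
      then have "T c * c \<le> T (e k) * e k"
        using monotone_onD[OF mono, of c "e k"] \<open>0 < c\<close> pos(1)[of c] pos(1)[of "e k"] pos(2)[of k]
        by (intro mult_mono) auto
      with elim le[of k] show False
        by simp
    qed
  qed
next
  fix c :: real
  assume "c < 0"
  then show "\<forall>\<^sub>F k in sequentially. c < e k"
    using pos(2) by (intro always_eventually allI) (meson order_less_trans)
qed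

text \<open>Condition (a) on \<open>G\<close> would make the first arguments tend to zero; condition (b) would give
  \<open>e k \<le> e (Suc k)\<close> for all large \<open>k\<close>.\<close>

lemma control_functions_no_vanishing_radii:
  assumes cf: "control_functions T1 T2 G" and "0 < m"
    and pos: "\<And>k. 0 < e k" and s: "\<And>k. m \<le> s k" and G: "\<And>k. G (s k) (e k) \<le> e (Suc k)"
  shows "\<not> e \<longlonglongrightarrow> 0"
proof
  assume e: "e \<longlonglongrightarrow> 0"
  have s_pos: "0 < s k" for k
    using s[of k] \<open>0 < m\<close> by simp
  have G_pos: "0 < G (s k) (e k)" for k
    by (intro control_functionsD(6)[OF cf] s_pos pos)
  consider "\<And>s t. (\<forall>k::nat. 0 < s k \<and> 0 < t k) \<Longrightarrow> (\<lambda>k. G (s k) (t k)) \<longlonglongrightarrow> 0 \<Longrightarrow> s \<longlonglongrightarrow> 0"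
    | "\<And>s0. 0 < s0 \<Longrightarrow> \<exists>t0>0. \<forall>s t. s0 < s \<longrightarrow> 0 < t \<longrightarrow> t < t0 \<longrightarrow> t \<le> G s t"
    using cf unfolding control_functions_def by blast
  then show False
  proof cases
    case 1
    have "(\<lambda>k. G (s k) (e k)) \<longlonglongrightarrow> 0"
      by (rule tendsto_sandwich[OF _ _ tendsto_const LIMSEQ_Suc[OF e]])
        (auto intro!: always_eventually less_imp_le[OF G_pos] G)
    then have "s \<longlonglongrightarrow> 0"
      using 1 s_pos pos by blast
    then have "m \<le> 0"
      by (rule LIMSEQ_le_const) (use s in blast)
    with \<open>0 < m\<close> show False
      by simp
  next
    case 2
    obtain t0 where t0: "0 < t0" "\<And>s t. m / 2 < s \<Longrightarrow> 0 < t \<Longrightarrow> t < t0 \<Longrightarrow> t \<le> G s t"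
      using 2[of "m / 2"] \<open>0 < m\<close> by auto
    obtain N where N: "\<And>k. N \<le> k \<Longrightarrow> e k < t0"
      using order_tendstoD(2)[OF e t0(1)] unfolding eventually_sequentially by blast
    have mono: "e k \<le> e (Suc k)" if "N \<le> k" for k
      using t0(2)[of "s k" "e k"] s[of k] \<open>0 < m\<close> pos[of k] N[OF that] G[of k] by linarith
    have "e N \<le> e k" if "N \<le> k" for k
      using that by (induction k rule: dec_induct) (auto intro: order_trans mono)
    then have "e N \<le> 0"
      by (intro LIMSEQ_le_const[OF e]) blast
    with pos[of N] show False
      by simp
  qed
qed


section \<open>Convergence of the algorithm\<close>

theorem theorem3p24:
  fixes f :: "'a::{real_inner, complete_space} \<Rightarrow> real"
    and xs :: "nat \<Rightarrow> 'a"
  assumes "locally_lipschitz f"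
    and "main_algorithm_iterates f xs"
  shows "(\<forall>m n. m < n \<longrightarrow> f (xs n) < f (xs m)) \<and>
         (\<forall>x. accumulation_point xs x \<longrightarrow>
            0 \<in> clarke_gradient inner f x \<and> (\<lambda>k. f (xs k)) \<longlonglongrightarrow> f x)"
proof -
  obtain T1 T2 G \<delta> C ip \<epsilon> where
      all: "\<forall>k. inner_product (ip k) \<and>
        (\<forall>z. 1 / C * norm z \<le> ip_norm (ip k) z \<and> ip_norm (ip k) z \<le> C * norm z) \<and>
        outer_step (ip k) f T1 T2 G \<delta> (xs k) (\<epsilon> k) (xs (Suc k)) (\<epsilon> (Suc k))"
      and cf: "control_functions T1 T2 G" and \<delta>: "0 < \<delta>" and C: "1 \<le> C" and "0 < \<epsilon> 0"
    using assms(2) unfolding main_algorithm_iterates_def by (elim exE conjE) (rule that)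
  have ip: "inner_product (ip k)"
      and lower: "1 / C * norm z \<le> ip_norm (ip k) z"
      and upper: "ip_norm (ip k) z \<le> C * norm z"
      and step: "outer_step (ip k) f T1 T2 G \<delta> (xs k) (\<epsilon> k) (xs (Suc k)) (\<epsilon> (Suc k))" for k z
    using all by blast+
  note T1 = control_functionsD(1-3)[OF cf] and T2 = control_functionsD(4)[OF cf]
  have \<epsilon>_pos: "0 < \<epsilon> k" for k
    by (induction k) (auto intro: \<open>0 < \<epsilon> 0\<close> outer_step_descent(1)[OF step ip cf \<delta>])
  have descent: "f (xs (Suc k)) \<le> f (xs k) - \<delta> * T1 (\<epsilon> (Suc k)) * \<epsilon> (Suc k)" for k
    by (rule outer_step_descent(2)[OF step ip cf \<delta> \<epsilon>_pos])
  have less: "f (xs (Suc k)) < f (xs k)" for k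
  proof -
    have "0 < \<delta> * T1 (\<epsilon> (Suc k)) * \<epsilon> (Suc k)"
      by (intro mult_pos_pos \<delta> T1(1) \<epsilon>_pos)
    with descent[of k] show ?thesis
      by simp
  qed
  have strictly_decreasing: "f (xs n) < f (xs m)" if "m < n" for m n
    using that by (induction rule: strict_inc_induct) (auto intro: less less_trans)
  have "0 \<in> clarke_gradient inner f x \<and> (\<lambda>k. f (xs k)) \<longlonglongrightarrow> f x"
    if "accumulation_point xs x" for x
  proof
    obtain r where r: "strict_mono r" "(xs \<circ> r) \<longlonglongrightarrow> x"
      using \<open>accumulation_point xs x\<close> unfolding accumulation_point_def by blast
    have "((\<lambda>k. f (xs k)) \<circ> r) \<longlonglongrightarrow> f x"
      using isCont_tendsto_compose[OF locally_lipschitz_isCont[OF assms(1)] r(2)]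
      by (simp add: o_def)
    moreover have "decseq (\<lambda>k. f (xs k))"
      by (intro decseq_SucI less_imp_le less)
    ultimately have f_lim: "(\<lambda>k. f (xs k)) \<longlonglongrightarrow> f x" and f_ge: "f x \<le> f (xs k)" for k
      using decseq_tendsto_of_subseq[OF _ r(1), of "\<lambda>k. f (xs k)" "f x"] by blast+
    show "(\<lambda>k. f (xs k)) \<longlonglongrightarrow> f x"
      by (rule f_lim)

    have decrease_lim: "(\<lambda>k. (f (xs k) - f (xs (Suc k))) / \<delta>) \<longlonglongrightarrow> 0"
      using tendsto_divide[OF tendsto_diff[OF f_lim LIMSEQ_Suc[OF f_lim]] tendsto_const[of \<delta>]] \<delta>
      by simp
    have weighted: "T1 (\<epsilon> (Suc k)) * \<epsilon> (Suc k) \<le> (f (xs k) - f (xs (Suc k))) / \<delta>" for k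
      using descent[of k] \<delta> by (simp add: field_simps)
    have "(\<lambda>k. \<epsilon> (Suc k)) \<longlonglongrightarrow> 0"
      by (rule tendsto_zero_of_weighted_bound[OF T1(2) _ _ weighted decrease_lim])
        (auto intro: T1(1) \<epsilon>_pos)
    then have \<epsilon>_lim: "\<epsilon> \<longlonglongrightarrow> 0"
      by (rule LIMSEQ_imp_Suc)

    show "0 \<in> clarke_gradient inner f x"
    proof (rule ccontr)
      assume "0 \<notin> clarke_gradient inner f x"
      then obtain h c \<rho> where "0 < c" "0 < \<rho>"
          and deriv: "\<And>y. dist y x < \<rho> \<Longrightarrow> clarke_deriv f y h \<le> ereal (- c)"
        by (rule nonstationary_descent_direction) (rule that)
      \<comment> \<open>\<open>m\<close> bounds from below the norms of all \<open>t\<close>-gradients with \<open>t < \<tau>\<close> at points within \<open>\<rho> / 2\<close> of \<open>x\<close>,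
        the other half of \<open>\<rho>\<close> being left for \<open>C * t\<close>; by \<open>t < b\<close> no such norm is below \<open>T1 t\<close>.\<close>
      define m where "m = c / (C * norm h + 1)"
      have "0 < m"
        unfolding m_def using \<open>0 < c\<close> C by (intro divide_pos_pos add_nonneg_pos) auto
      obtain b where "0 < b" and b: "\<And>t. 0 < t \<Longrightarrow> t < b \<Longrightarrow> T1 t < m"
        using order_tendstoD(2)[OF T1(3) \<open>0 < m\<close>] unfolding eventually_at_right_field by auto
      define \<tau> where "\<tau> = min b (\<rho> / (2 * C))"
      have "0 < \<tau>" and \<tau>: "C * \<tau> \<le> \<rho> / 2"
        using \<open>0 < b\<close> \<open>0 < \<rho>\<close> C by (auto simp: \<tau>_def min_def field_simps)
      have bound: "m \<le> ip_norm (ip k) g"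
        if "dist (xs k) x < \<rho> / 2" "t < \<tau>" "g \<in> eps_gradient (ip k) f t (xs k)" for k t g
      proof -
        have "C * t \<le> C * \<tau>"
          using \<open>t < \<tau>\<close> C by simp
        then have "dist (xs k) x + C * t < \<rho>"
          using that(1) \<tau> by simp
        then show ?thesis
          unfolding m_def using C that(3)
          by (intro eps_gradient_norm_lower_bound[OF ip _ lower upper deriv]) auto
      qed
      have "\<forall>\<^sub>F k in sequentially. \<epsilon> (Suc k) < min \<tau> (T2 \<tau>)"
        using \<open>0 < \<tau>\<close> T2 by (intro order_tendstoD(2)[OF LIMSEQ_Suc[OF \<epsilon>_lim]]) simp
      then obtain N where N: "\<And>k. N \<le> k \<Longrightarrow> \<epsilon> (Suc k) < \<tau> \<and> \<epsilon> (Suc k) < T2 \<tau>"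
        unfolding eventually_sequentially by auto
      have late: "\<exists>s\<ge>m. G s (\<epsilon> k) \<le> \<epsilon> (Suc k)"
          "\<delta> * m * ip_norm (ip k) (xs (Suc k) - xs k) \<le> f (xs k) - f (xs (Suc k))"
        if "N \<le> k" "dist (xs k) x < \<rho> / 2" for k
        using N[OF that(1)] bound[OF that(2)] b
          outer_step_without_null_steps[OF step ip cf \<delta> \<epsilon>_pos \<epsilon>_pos \<open>0 < m\<close> \<open>0 < \<tau>\<close>]
        by (simp_all add: \<tau>_def less_imp_le)
      \<comment> \<open>The factor converts descent into length in the original norm: \<open>C\<close> compares the norms,
        and \<open>\<delta> * m\<close> is the guaranteed descent per unit of length.\<close>
      define \<phi> where "\<phi> k = C / (\<delta> * m) * f (xs k)" for k
      have short: "dist (xs (Suc k)) (xs k) \<le> \<phi> k - \<phi> (Suc k)"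
        if "N \<le> k" "dist (xs k) x < \<rho> / 2" for k
      proof -
        have "dist (xs (Suc k)) (xs k) \<le> C * ip_norm (ip k) (xs (Suc k) - xs k)"
          using lower[of "xs (Suc k) - xs k" k] C by (simp add: dist_norm field_simps)
        also have "\<dots> \<le> C * ((f (xs k) - f (xs (Suc k))) / (\<delta> * m))"
          using late(2)[OF that] C \<delta> \<open>0 < m\<close> by (intro mult_left_mono) (auto simp: field_simps)
        also have "\<dots> = \<phi> k - \<phi> (Suc k)"
          by (simp add: \<phi>_def diff_divide_distrib right_diff_distrib)
        finally show ?thesis .
      qed
      define l where "l = C / (\<delta> * m) * f x"
      have l: "l \<le> \<phi> k" for k
        unfolding l_def \<phi>_def using C \<delta> \<open>0 < m\<close> by (intro mult_left_mono f_ge) auto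
      have "\<phi> \<longlonglongrightarrow> l"
        unfolding l_def \<phi>_def by (intro tendsto_intros f_lim)
      then have "(\<lambda>j. dist (xs (r j)) x + \<phi> (r j)) \<longlonglongrightarrow> dist x x + l"
        using r(2) LIMSEQ_subseq_LIMSEQ[OF _ r(1)]
        by (intro tendsto_intros) (auto simp: o_def)
      then have "\<forall>\<^sub>F j in sequentially. dist (xs (r j)) x + \<phi> (r j) < \<rho> / 2 + l"
        using \<open>0 < \<rho>\<close> by (intro order_tendstoD(2)) auto
      then obtain j where j: "N \<le> j" "dist (xs (r j)) x + \<phi> (r j) < \<rho> / 2 + l"
        unfolding eventually_sequentially by (meson linear)
      define K where "K = r j"
      have "N \<le> K"
        using j(1) seq_suble[OF r(1), of j] by (simp add: K_def)
      have near: "dist (xs k) x < \<rho> / 2" if "K \<le> k" for k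
      proof (rule trapped_by_descent[OF _ l _ that])
        show "dist (xs K) x + \<phi> K < \<rho> / 2 + l"
          using j(2) by (simp add: K_def)
      qed (use short \<open>N \<le> K\<close> in auto)
      have "\<forall>k. \<exists>s\<ge>m. G s (\<epsilon> (k + K)) \<le> \<epsilon> (Suc (k + K))"
        using late(1) near \<open>N \<le> K\<close> by simp
      then obtain s where s: "\<And>k. m \<le> s k" "\<And>k. G (s k) (\<epsilon> (k + K)) \<le> \<epsilon> (Suc k + K)"
        by (metis add_Suc)
      have "\<not> (\<lambda>k. \<epsilon> (k + K)) \<longlonglongrightarrow> 0"
        by (rule control_functions_no_vanishing_radii[OF cf \<open>0 < m\<close>]) (rule \<epsilon>_pos s)+
      then show False
        using LIMSEQ_ignore_initial_segment[OF \<epsilon>_lim] by blast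
    qed
  qed
  with strictly_decreasing show ?thesis
    by blast
qed

end
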